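(* Let $0<\lambda<1$. The following hold. (a) For every $x_0\in X$, $\bar c\in\mathcal{C}^{\mathbb{N}}$ and $\bar a\in\mathcal{I}^{\mathbb{N}}$, $\mu^\lambda_{x_0,\bar c,\bar a}\in\mathcal{H}^\lambda(\delta_{x_0})$. (b) Let $x_0$ be a point where $v_\lambda$ attains its maximum over $X$, and let $\nu=\delta_{x_0}$. If the pair $(\bar c,\bar a)\in\mathcal{C}^{\mathbb{N}}\times\mathcal{I}^{\mathbb{N}}$ is optimal at $x_0$, then $m_\lambda(R)=(1-\lambda)\max_{x\in X}v_\lambda(x)$ and $\mu^\lambda=\mu^\lambda_{x_0,\bar c,\bar a}\in\mathcal{H}^\lambda(\delta_{x_0})$ solves the discounted IFS ergodic optimization problem, that is, $\int A_c(\tau_a(x))\,d\mu^\lambda(x,c,a)=m_\lambda(R)$.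
   Context: $(X,d)$ is a compact metric space, $\mathcal{C}$ and $\mathcal{I}$ are finite nonempty sets, $R=(X,\tau_a)_{a\in\mathcal{I}}$ is a contractive IFS (each $\tau_a:X\to X$ is a contraction), and $A_c:X\to\mathbb{R}$, $c\in\mathcal{C}$, are Lipschitz functions. For $w\in C^0(X,\mathbb{R})$ put $d_x^\lambda w(a)=\lambda w(\tau_a(x))-w(x)$. For $\nu\in\mathrm{Prob}(X)$, $$\mathcal{H}^\lambda(\nu)=\left\{\mu\in\mathrm{Prob}(X\times\mathcal{C}\times\mathcal{I}) : \int d_x^\lambda w(a)\,d\mu(x,c,a)=-(1-\lambda)\int w\,d\nu\ \ \forall w\in C^0(X,\mathbb{R})\right\},$$ and $m_\lambda(R)=\sup_{\mu\in\mathcal{H}^\lambda(\nu)}\int A_c(\tau_a(x))\,d\mu(x,c,a)$. $v_\lambda$ is the unique continuous solution of the Bellman equation $v_\lambda(x)=\max_{(c,a)\in\mathcal{C}\times\mathcal{I}}[A_c(\tau_a(x))+\lambda v_\lambda(\tau_a(x))]$. Given $x_0\in X$, $\bar c=(c_0,c_1,\dots)$ and $\bar a=(a_0,a_1,\dots)$, put $x_{i+1}=\tau_{a_i}(x_i)$. The empirical discounted probability measure $\mu^\lambda_{x_0,\bar c,\bar a}$ is defined by $\int g\,d\mu^\lambda_{x_0,\bar c,\bar a}=(1-\lambda)\sum_{i=0}^\infty\lambda^ig(x_i,c_i,a_i)$ for $g\in C^0(X\times\mathcal{C}\times\mathcal{I},\mathbb{R})$. The pair $(\bar c,\bar a)$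 is optimal at $x_0$ if $v_\lambda(x_i)=A_{c_i}(\tau_{a_i}(x_i))+\lambda v_\lambda(\tau_{a_i}(x_i))$ for all $i\ge0$ (equivalently $\sum_{i\ge0}\lambda^iA_{c_i}(x_{i+1})=v_\lambda(x_0)$). *)

theory Defs
  imports "HOL-Probability.Probability"
begin

text \<open>
  The compact metric space is a type \<open>'x::metric_space\<close> with \<open>compact UNIV\<close>; the finite
  nonempty index sets are types of sort \<open>{finite, discrete_topology}\<close>, so that continuity and
  Borel sets on the product \<open>'x \<times> 'c \<times> 'i\<close> are the library's.
\<close>

definition contractive_ifs :: "('i \<Rightarrow> 'x::metric_space \<Rightarrow> 'x) \<Rightarrow> bool" where
  "contractive_ifs \<tau> \<longleftrightarrow> (\<forall>a. \<exists>k<1. k-lipschitz_on UNIV (\<tau> a))"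

definition Prob :: "'a::topological_space measure set" where
  "Prob = {\<mu>. prob_space \<mu> \<and> sets \<mu> = sets borel}"

definition disc_diff ::
    "real \<Rightarrow> ('i \<Rightarrow> 'x \<Rightarrow> 'x) \<Rightarrow> ('x \<Rightarrow> real) \<Rightarrow> 'x \<Rightarrow> 'i \<Rightarrow> real" where
  "disc_diff lam \<tau> w x a = lam * w (\<tau> a x) - w x"

definition holonomic ::
    "real \<Rightarrow> ('i \<Rightarrow> 'x \<Rightarrow> 'x) \<Rightarrow> 'x::metric_space measure \<Rightarrow>
     ('x \<times> 'c::{finite,discrete_topology} \<times> 'i::{finite,discrete_topology}) measure set" where
  "holonomic lam \<tau> \<nu> = {\<mu> \<in> Prob. \<forall>w. continuous_on UNIV w \<longrightarrow>
     (\<integral>(x, c, a). disc_diff lam \<tau> w x a \<partial>\<mu>) = - (1 - lam) * (\<integral>x. w x \<partial>\<nu>)}"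

definition payoff ::
    "('c \<Rightarrow> 'x \<Rightarrow> real) \<Rightarrow> ('i \<Rightarrow> 'x \<Rightarrow> 'x) \<Rightarrow>
     ('x \<times> 'c \<times> 'i) measure \<Rightarrow> real" where
  "payoff A \<tau> \<mu> = (\<integral>(x, c, a). A c (\<tau> a x) \<partial>\<mu>)"

definition max_payoff ::
    "real \<Rightarrow> ('c::{finite,discrete_topology} \<Rightarrow> 'x::metric_space \<Rightarrow> real) \<Rightarrow>
     ('i::{finite,discrete_topology} \<Rightarrow> 'x \<Rightarrow> 'x) \<Rightarrow> 'x measure \<Rightarrow> real" where
  "max_payoff lam A \<tau> \<nu> = (SUP \<mu> \<in> holonomic lam \<tau> \<nu>. payoff A \<tau> \<mu>)"

text \<open>Existence and uniqueness of the function and the measure selected by \<open>THE\<close> below hold for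
  \<open>0 < lam < 1\<close>, a compact space and continuous maps: the former by Banach's fixed point theorem, the latter since
  Borel probability measures are determined by their integrals of continuous functions.\<close>

definition bellman_value ::
    "real \<Rightarrow> ('c::finite \<Rightarrow> 'x::metric_space \<Rightarrow> real) \<Rightarrow> ('i::finite \<Rightarrow> 'x \<Rightarrow> 'x) \<Rightarrow>
     'x \<Rightarrow> real" where
  "bellman_value lam A \<tau> = (THE v. continuous_on UNIV v \<and>
     (\<forall>x. v x = (MAX (c, a) \<in> UNIV. A c (\<tau> a x) + lam * v (\<tau> a x))))"

primrec orbit :: "('i \<Rightarrow> 'x \<Rightarrow> 'x) \<Rightarrow> 'x \<Rightarrow> (nat \<Rightarrow> 'i) \<Rightarrow> nat \<Rightarrow> 'x" where
  "orbit \<tau> x0 a 0 = x0"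
| "orbit \<tau> x0 a (Suc i) = \<tau> (a i) (orbit \<tau> x0 a i)"

definition empirical ::
    "real \<Rightarrow> ('i \<Rightarrow> 'x \<Rightarrow> 'x) \<Rightarrow> 'x::metric_space \<Rightarrow> (nat \<Rightarrow> 'c) \<Rightarrow> (nat \<Rightarrow> 'i) \<Rightarrow>
     ('x \<times> 'c::{finite,discrete_topology} \<times> 'i::{finite,discrete_topology}) measure" where
  "empirical lam \<tau> x0 c a = (THE \<mu>. \<mu> \<in> Prob \<and>
     (\<forall>g. continuous_on UNIV g \<longrightarrow>
        (\<integral>p. g p \<partial>\<mu>) = (1 - lam) * (\<Sum>i. lam ^ i * g (orbit \<tau> x0 a i, c i, a i))))"

definition optimal_at ::
    "real \<Rightarrow> ('c::finite \<Rightarrow> 'x::metric_space \<Rightarrow> real) \<Rightarrow> ('i::finite \<Rightarrow> 'x \<Rightarrow> 'x) \<Rightarrow>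
     'x \<Rightarrow> (nat \<Rightarrow> 'c) \<Rightarrow> (nat \<Rightarrow> 'i) \<Rightarrow> bool" where
  "optimal_at lam A \<tau> x0 c a \<longleftrightarrow>
     (\<forall>i. bellman_value lam A \<tau> (orbit \<tau> x0 a i) =
          A (c i) (\<tau> (a i) (orbit \<tau> x0 a i)) +
          lam * bellman_value lam A \<tau> (\<tau> (a i) (orbit \<tau> x0 a i)))"

end

theory Submission
  imports Defs
begin

text \<open>
  Write \<open>v\<close> for the Bellman value. The Bellman equation says two things: the inequality
  \<open>A c (\<tau> a x) \<le> v x - lam * v (\<tau> a x)\<close> holds everywhere, and it is an equality along an
  optimal orbit. The right-hand side is \<open>- disc_diff lam \<tau> v x a\<close>, and its integral over any
  holonomic measure is prescribed to be \<open>(1 - lam) * (\<integral>x. v x \<partial>\<nu>)\<close>. Integrating the inequality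
  therefore bounds every payoff by this number (\<open>payoff_holonomic_le\<close>), while the empirical
  measure of an optimal orbit, which lives on the points of equality, attains it
  (\<open>payoff_empirical_eq\<close>). For \<open>\<nu>\<close> a Dirac measure at a maximum point of \<open>v\<close> the common value is
  \<open>(1 - lam) * (SUP x. v x)\<close>. That empirical measures are holonomic for the Dirac measure at the
  starting point (\<open>empirical_holonomic\<close>) is a telescoping series.

  Both \<open>bellman_value\<close> and \<open>empirical\<close> are definite descriptions, so existence and uniqueness
  have to be established before anything can be said about them. For the first, the Bellman
  operator is a contraction with factor \<open>lam\<close> on the Banach space of bounded continuous functions
  (\<open>bellman_value_solves\<close>). For the second, existence holds because the weights
  \<open>(1 - lam) * lam ^ i\<close> are those of a geometric distribution, whose image under
  \<open>i \<mapsto> (x\<^sub>i, c\<^sub>i, a\<^sub>i)\<close> has the required integrals, and uniqueness holds because indicators of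
  closed sets are limits of bounded sequences of continuous functions
  (\<open>empirical_characterization\<close>).
\<close>

section \<open>Discounted fixed-point equations with a finite maximum\<close>

lemma continuous_on_MAX:
  fixes f :: "'p \<Rightarrow> 'x::topological_space \<Rightarrow> 'b::linorder_topology"
  assumes "finite P" and "P \<noteq> {}" and "\<And>p. p \<in> P \<Longrightarrow> continuous_on S (f p)"
  shows "continuous_on S (\<lambda>x. MAX p\<in>P. f p x)"
  using assms
proof (induction P rule: finite_ne_induct)
  case (singleton p)
  then show ?case by simp
next
  case (insert p P)
  have "continuous_on S (\<lambda>x. max (f p x) (MAX p\<in>P. f p x))"
    using insert by (intro continuous_on_max) auto
  then show ?case using insert by simp
qed

text \<open>Taking a maximum is nonexpansive for the supremum distance; this turns the factor \<open>lam\<close> inside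
  the maximum into the contraction factor of the Bellman operator.\<close>

lemma MAX_dist_le:
  fixes f g :: "'p \<Rightarrow> real"
  assumes "finite P" and "P \<noteq> {}" and le: "\<And>p. p \<in> P \<Longrightarrow> \<bar>f p - g p\<bar> \<le> B"
  shows "\<bar>(MAX p\<in>P. f p) - (MAX p\<in>P. g p)\<bar> \<le> B"
proof -
  have "(MAX p\<in>P. f p) \<le> (MAX p\<in>P. g p) + B"
    if "\<And>p. p \<in> P \<Longrightarrow> f p \<le> g p + B" for f g :: "'p \<Rightarrow> real"
  proof (rule Max.boundedI)
    fix y assume "y \<in> f ` P"
    then obtain p where p: "p \<in> P" "y = f p" by auto
    moreover have "g p \<le> (MAX p\<in>P. g p)" using p assms by auto
    ultimately show "y \<le> (MAX p\<in>P. g p) + B" using that[of p] by linarith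
  qed (use assms in auto)
  from this[of f g] this[of g f] le show ?thesis by (fastforce simp: abs_le_iff)
qed

lemma bounded_of_continuous_on_UNIV:
  fixes f :: "'a::topological_space \<Rightarrow> real"
  assumes "compact (UNIV :: 'a set)" and "continuous_on UNIV f"
  obtains B where "\<And>x. \<bar>f x\<bar> \<le> B"
  using compact_imp_bounded[OF compact_continuous_image[OF assms(2,1)]]
  by (auto simp: bounded_iff)

text \<open>Banach's fixed point theorem for the operator \<open>G\<close> below. It is applied in the type of bounded
  continuous functions, which is complete; compactness makes every continuous function a member
  of it, so the fixed point is unique among all continuous functions.\<close>

lemma ex1_discounted_max_equation:
  fixes f :: "'p::finite \<Rightarrow> 'x::metric_space \<Rightarrow> real" and \<sigma> :: "'p \<Rightarrow> 'x \<Rightarrow> 'x"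
  assumes comp: "compact (UNIV :: 'x set)" and lam: "0 \<le> lam" "lam < 1"
    and f: "\<And>p. continuous_on UNIV (f p)" and \<sigma>: "\<And>p. continuous_on UNIV (\<sigma> p)"
  shows "\<exists>!v. continuous_on UNIV v \<and> (\<forall>x. v x = (MAX p\<in>UNIV. f p x + lam * v (\<sigma> p x)))"
proof -
  define G where "G v x = (MAX p\<in>UNIV. f p x + lam * v (\<sigma> p x))" for v x
  have bc: "v \<in> bcontfun" if "continuous_on UNIV v" for v :: "'x \<Rightarrow> real"
    using that compact_imp_bounded[OF compact_continuous_image[OF that comp]]
    by (simp add: bcontfun_def)
  have G_cont: "continuous_on UNIV (G v)" if "continuous_on UNIV v" for v
    unfolding G_def
    by (intro continuous_on_MAX continuous_intros f
          continuous_on_compose2[OF that \<sigma>]) auto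
  define T where "T v = Bcontfun (G (apply_bcontfun v))" for v
  have T: "apply_bcontfun (T v) = G (apply_bcontfun v)" for v
    unfolding T_def by (intro Bcontfun_inverse bc G_cont) auto
  have "dist (T v) (T w) \<le> lam * dist v w" for v w
  proof (rule dist_bound)
    fix x
    have "\<bar>(f p x + lam * v (\<sigma> p x)) - (f p x + lam * w (\<sigma> p x))\<bar> \<le> lam * dist v w" for p
    proof -
      have "\<bar>(f p x + lam * v (\<sigma> p x)) - (f p x + lam * w (\<sigma> p x))\<bar>
          = lam * dist (v (\<sigma> p x)) (w (\<sigma> p x))"
        using lam by (simp add: dist_real_def abs_mult flip: right_diff_distrib)
      also have "\<dots> \<le> lam * dist v w" using lam by (intro mult_left_mono dist_bounded)
      finally show ?thesis .
    qed
    then show "dist (T v x) (T w x) \<le> lam * dist v w"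
      unfolding T G_def dist_real_def by (intro MAX_dist_le) auto
  qed
  then have ex1: "\<exists>!v. T v = v" using banach_fix_type[OF lam] by blast
  then obtain v where v: "T v = v" by blast
  show ?thesis
  proof (rule ex1I[of _ "apply_bcontfun v"])
    show "continuous_on UNIV v \<and> (\<forall>x. v x = (MAX p\<in>UNIV. f p x + lam * v (\<sigma> p x)))"
    proof (intro conjI allI)
      have "apply_bcontfun v = G (apply_bcontfun v)" using T[of v] unfolding v .
      then show "v x = (MAX p\<in>UNIV. f p x + lam * v (\<sigma> p x))" for x
        unfolding G_def by (rule fun_cong)
    qed simp
  next
    fix w assume w: "continuous_on UNIV w \<and> (\<forall>x. w x = (MAX p\<in>UNIV. f p x + lam * w (\<sigma> p x)))"
    have Bw: "apply_bcontfun (Bcontfun w) = w"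
      by (intro Bcontfun_inverse bc conjunct1[OF w])
    have "G w = w"
      unfolding G_def by (rule ext) (rule conjunct2[OF w, THEN spec, symmetric])
    then have "T (Bcontfun w) = Bcontfun w"
      by (intro bcontfun_eqI) (simp add: T Bw)
    then have "Bcontfun w = v" using ex1 v by blast
    then show "w = apply_bcontfun v" using Bw by simp
  qed
qed

text \<open>The finite index set of the maximum is the set of pairs \<open>(c, a)\<close>, and the running reward of
  such a pair is \<open>A c \<circ> \<tau> a\<close>.\<close>

lemma bellman_value_solves:
  fixes \<tau> :: "'i::finite \<Rightarrow> 'x::metric_space \<Rightarrow> 'x" and A :: "'c::finite \<Rightarrow> 'x \<Rightarrow> real"
  assumes "compact (UNIV :: 'x set)" and "0 \<le> lam" and "lam < 1"
    and A: "\<And>c. continuous_on UNIV (A c)" and \<tau>: "\<And>a. continuous_on UNIV (\<tau> a)"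
  shows "continuous_on UNIV (bellman_value lam A \<tau>)"
    and "bellman_value lam A \<tau> x
      = (MAX (c, a)\<in>UNIV. A c (\<tau> a x) + lam * bellman_value lam A \<tau> (\<tau> a x))"
proof -
  have "\<exists>!v. continuous_on UNIV v \<and>
      (\<forall>x. v x = (MAX p\<in>UNIV. A (fst p) (\<tau> (snd p) x) + lam * v (\<tau> (snd p) x)))"
    using assms(1-3) by (intro ex1_discounted_max_equation \<tau> continuous_on_compose2[OF A \<tau>]) auto
  then have "\<exists>!v. continuous_on UNIV v \<and>
      (\<forall>x. v x = (MAX (c, a)\<in>UNIV. A c (\<tau> a x) + lam * v (\<tau> a x)))"
    by (simp add: case_prod_beta)
  from theI'[OF this]
  show "continuous_on UNIV (bellman_value lam A \<tau>)"
    and "bellman_value lam A \<tau> x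
      = (MAX (c, a)\<in>UNIV. A c (\<tau> a x) + lam * bellman_value lam A \<tau> (\<tau> a x))"
    unfolding bellman_value_def[symmetric] by blast+
qed

lemma bellman_value_ge:
  fixes \<tau> :: "'i::finite \<Rightarrow> 'x::metric_space \<Rightarrow> 'x" and A :: "'c::finite \<Rightarrow> 'x \<Rightarrow> real"
  assumes "compact (UNIV :: 'x set)" and "0 \<le> lam" and "lam < 1"
    and "\<And>c. continuous_on UNIV (A c)" and "\<And>a. continuous_on UNIV (\<tau> a)"
  shows "A c (\<tau> a x) + lam * bellman_value lam A \<tau> (\<tau> a x) \<le> bellman_value lam A \<tau> x"
proof -
  have "A c (\<tau> a x) + lam * bellman_value lam A \<tau> (\<tau> a x)
      \<le> (MAX (c, a)\<in>UNIV. A c (\<tau> a x) + lam * bellman_value lam A \<tau> (\<tau> a x))"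
    by (rule Max_ge[OF finite_imageI[OF finite] image_eqI[of _ _ "(c, a)"]]) simp_all
  also have "\<dots> = bellman_value lam A \<tau> x"
    by (rule bellman_value_solves(2)[OF assms, symmetric])
  finally show ?thesis .
qed

section \<open>Probability measures determined by integrals of continuous functions\<close>

text \<open>If \<open>F\<close> is the zero set of a continuous \<open>g \<ge> 0\<close>, then the functions \<open>max 0 (1 - n * g)\<close> are
  continuous, lie between \<open>0\<close> and \<open>1\<close> and tend pointwise to the indicator of \<open>F\<close>, so by dominated
  convergence the integrals of continuous functions determine the measure of \<open>F\<close>. The closed sets
  are stable under intersection and generate the Borel sets. Stating this through zero sets avoids
  a metric on the finite factors of \<open>'x \<times> 'c \<times> 'i\<close>.\<close>

lemma Prob_eqI_zero_sets:
  fixes M N :: "'a::topological_space measure"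
  assumes zero: "\<And>F. closed F \<Longrightarrow> \<exists>g :: 'a \<Rightarrow> real. continuous_on UNIV g \<and>
      (\<forall>x. 0 \<le> g x) \<and> F = {x. g x = 0}"
    and M: "M \<in> Prob" and N: "N \<in> Prob"
    and eq: "\<And>g :: 'a \<Rightarrow> real. continuous_on UNIV g \<Longrightarrow> (\<integral>x. g x \<partial>M) = (\<integral>x. g x \<partial>N)"
  shows "M = N"
proof -
  have "emeasure M F = emeasure N F" if F: "closed F" for F
  proof -
    obtain g :: "'a \<Rightarrow> real" where g: "continuous_on UNIV g" "\<And>x. 0 \<le> g x" "F = {x. g x = 0}"
      using zero[OF F] by blast
    define h where "h n x = max 0 (1 - real n * g x)" for n x
    have h_cont: "continuous_on UNIV (h n)" for n
      unfolding h_def by (intro continuous_intros g)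
    have h_le: "norm (h n x) \<le> 1" for n x using g(2)[of x] by (simp add: h_def)
    have h_lim: "(\<lambda>n. h n x) \<longlonglongrightarrow> indicator F x" for x
    proof (cases "g x = 0")
      case True
      then show ?thesis using g(3) by (simp add: h_def)
    next
      case False
      then have "0 < g x" using g(2)[of x] by simp
      then obtain m where m: "1 < real m * g x" using reals_Archimedean3 by blast
      have "h n x = 0" if "m \<le> n" for n
      proof -
        have "real m * g x \<le> real n * g x" using that \<open>0 < g x\<close> by simp
        then show ?thesis using m by (simp add: h_def)
      qed
      then have "\<forall>\<^sub>F n in sequentially. h n x = indicator F x"
        using False g(3) by (auto simp: eventually_sequentially)
      then show ?thesis by (rule tendsto_eventually)
    qed
    have lim: "(\<lambda>n. \<integral>x. h n x \<partial>L) \<longlonglongrightarrow> measure L F" if "L \<in> Prob" for L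
    proof -
      interpret prob_space L using that by (simp add: Prob_def)
      have sets_L[measurable_cong]: "sets L = sets borel" using that by (simp add: Prob_def)
      have [measurable]: "F \<in> sets borel" using F by simp
      have [measurable]: "h n \<in> borel_measurable borel" for n
        by (rule borel_measurable_continuous_onI[OF h_cont])
      have "(\<lambda>n. \<integral>x. h n x \<partial>L) \<longlonglongrightarrow> (\<integral>x. indicator F x \<partial>L)"
        by (rule integral_dominated_convergence[where w = "\<lambda>_. 1"]) (use h_lim h_le in auto)
      then show ?thesis by (simp add: sets_L)
    qed
    have "measure M F = measure N F"
      using LIMSEQ_unique[OF lim[OF M]] lim[OF N] by (simp add: eq[OF h_cont])
    then show ?thesis
      using M N by (simp add: Prob_def prob_space_def finite_measure.emeasure_eq_measure)
  qed
  moreover have "sets borel = sigma_sets UNIV (Collect closed :: 'a set set)"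
    by (simp add: borel_eq_closed)
  ultimately show ?thesis
    using M N
    by (intro measure_eqI_generator_eq[where E = "Collect closed" and \<Omega> = UNIV and A = "\<lambda>_. UNIV"])
       (auto simp: Int_stable_def Prob_def prob_space_def finite_measure.emeasure_finite)
qed

lemma continuous_on_prod_discrete:
  fixes g :: "'x::topological_space \<times> 'c::discrete_topology \<times> 'i::discrete_topology \<Rightarrow> 'b::topological_space"
  assumes "\<And>c a. continuous_on UNIV (\<lambda>x. g (x, c, a))"
  shows "continuous_on UNIV g"
  unfolding continuous_on_def
proof
  fix p :: "'x \<times> 'c \<times> 'i"
  obtain x c a where p: "p = (x, c, a)" by (cases p) auto
  have "((\<lambda>x. g (x, c, a)) \<longlongrightarrow> g (x, c, a)) (nhds x)"
    using assms[of c a]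
    by (simp add: continuous_on_def tendsto_at_iff_tendsto_nhds[where g = "\<lambda>x. g (x, c, a)"])
  moreover have "filtermap (\<lambda>x. (x, c, a)) (nhds x) = nhds p"
    by (simp add: p nhds_prod nhds_discrete principal_prod_principal prod_filter_principal_singleton2)
  ultimately have "(g \<longlongrightarrow> g p) (nhds p)"
    unfolding p by (metis filterlim_filtermap)
  then show "(g \<longlongrightarrow> g p) (at p within UNIV)"
    by (simp add: tendsto_at_iff_tendsto_nhds)
qed

text \<open>On each slice of a closed set the distance to the slice serves as the required function.
  An empty slice needs a separate value since \<open>infdist x {} = 0\<close>.\<close>

lemma closed_zero_set_prod_discrete:
  fixes F :: "('x::metric_space \<times> 'c::discrete_topology \<times> 'i::discrete_topology) set"
  assumes "closed F"
  shows "\<exists>g :: _ \<Rightarrow> real. continuous_on UNIV g \<and> (\<forall>p. 0 \<le> g p) \<and> F = {p. g p = 0}"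
proof -
  define S where "S c a = {x. (x, c, a) \<in> F}" for c a
  have S: "closed (S c a)" for c a
    using continuous_closed_vimage[OF assms, of "\<lambda>x. (x, c, a)"]
    by (simp add: S_def vimage_def)
  define g where "g = (\<lambda>(x, c, a). if S c a = {} then 1 else infdist x (S c a))"
  have iff: "p \<in> F \<longleftrightarrow> g p = 0" for p
  proof (cases p)
    case (fields x c a)
    have "p \<in> F \<longleftrightarrow> x \<in> S c a" by (simp add: S_def fields)
    also have "\<dots> \<longleftrightarrow> g p = 0"
      using in_closed_iff_infdist_zero[OF S, of c a x] by (auto simp: g_def fields)
    finally show ?thesis .
  qed
  have "continuous_on UNIV g"
  proof (rule continuous_on_prod_discrete)
    show "continuous_on UNIV (\<lambda>x. g (x, c, a))" for c a
      by (cases "S c a = {}") (auto simp: g_def intro!: continuous_intros)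
  qed
  moreover have "\<forall>p. 0 \<le> g p" by (auto simp: g_def infdist_nonneg)
  moreover have "F = {p. g p = 0}" using iff by blast
  ultimately show ?thesis by (intro exI[of _ g] conjI)
qed

section \<open>The empirical discounted measure\<close>

lemma integral_geometric_pmf:
  fixes f :: "nat \<Rightarrow> real"
  assumes lam: "0 < lam" "lam < 1" and f: "\<And>i. \<bar>f i\<bar> \<le> B"
  shows "(\<integral>i. f i \<partial>geometric_pmf (1 - lam)) = (1 - lam) * (\<Sum>i. lam ^ i * f i)"
proof -
  have "summable (\<lambda>i. \<bar>lam ^ i * f i\<bar>)"
  proof (rule summable_comparison_test')
    show "summable (\<lambda>i. lam ^ i * B)"
      using lam by (intro summable_mult2 summable_geometric) simp
    show "norm \<bar>lam ^ i * f i\<bar> \<le> lam ^ i * B" for i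
      using lam f by (simp add: abs_mult mult_left_mono)
  qed
  then have "summable (\<lambda>i. norm ((1 - lam) * (lam ^ i * f i)))"
    unfolding real_norm_def abs_mult[of "1 - lam"] by (rule summable_mult)
  then have int: "integrable (count_space UNIV) (\<lambda>i. (1 - lam) * (lam ^ i * f i))"
    unfolding integrable_count_space_nat_iff .
  have "(\<integral>i. f i \<partial>geometric_pmf (1 - lam))
      = (\<integral>i. (1 - lam) * (lam ^ i * f i) \<partial>count_space UNIV)"
    unfolding measure_pmf_eq_density using lam
    by (subst integral_density) (auto simp: mult_ac)
  also have "\<dots> = (\<Sum>i. (1 - lam) * (lam ^ i * f i))"
    by (rule integral_count_space_nat[OF int])
  also have "\<dots> = (1 - lam) * (\<Sum>i. lam ^ i * f i)"
    using \<open>summable (\<lambda>i. \<bar>lam ^ i * f i\<bar>)\<close>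
    by (intro suminf_mult) (auto dest: summable_rabs_cancel)
  finally show ?thesis .
qed

lemma compact_UNIV_prod_finite:
  assumes "compact (UNIV :: 'x::topological_space set)"
  shows "compact (UNIV :: ('x \<times> 'c::{finite,topological_space} \<times> 'i::{finite,topological_space}) set)"
  unfolding UNIV_Times_UNIV[symmetric]
  by (intro compact_Times assms finite_imp_compact finite)

text \<open>The measure is the law of the state-action triple at a random time whose distribution is
  geometric; this representation supplies existence, and the definite description is resolved by
  the uniqueness result for measures with equal integrals.\<close>

lemma empirical_characterization:
  fixes \<tau> :: "'i::{finite,discrete_topology} \<Rightarrow> 'x::metric_space \<Rightarrow> 'x"
    and c :: "nat \<Rightarrow> 'c::{finite,discrete_topology}"
  assumes comp: "compact (UNIV :: 'x set)" and lam: "0 < lam" "lam < 1"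
  shows "empirical lam \<tau> x0 c a \<in> Prob"
    and "continuous_on UNIV g \<Longrightarrow> (\<integral>p. g p \<partial>empirical lam \<tau> x0 c a)
      = (1 - lam) * (\<Sum>i. lam ^ i * g (orbit \<tau> x0 a i, c i, a i))"
proof -
  define s where "s i = (orbit \<tau> x0 a i, c i, a i)" for i
  define P where "P \<mu> \<longleftrightarrow> \<mu> \<in> Prob \<and> (\<forall>g. continuous_on UNIV g \<longrightarrow>
      (\<integral>p. g p \<partial>\<mu>) = (1 - lam) * (\<Sum>i. lam ^ i * g (s i)))" for \<mu>
  define \<mu> where "\<mu> = distr (measure_pmf (geometric_pmf (1 - lam))) borel s"
  have "P \<mu>" unfolding P_def
  proof (intro conjI allI impI)
    show "\<mu> \<in> Prob" unfolding \<mu>_def Prob_def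
      by (auto intro!: prob_space.prob_space_distr measure_pmf.prob_space_axioms)
    fix g :: "'x \<times> 'c \<times> 'i \<Rightarrow> real" assume g: "continuous_on UNIV g"
    obtain B where "\<And>p. \<bar>g p\<bar> \<le> B"
      using bounded_of_continuous_on_UNIV[OF compact_UNIV_prod_finite[OF comp] g] by blast
    then have "(\<integral>i. g (s i) \<partial>geometric_pmf (1 - lam)) = (1 - lam) * (\<Sum>i. lam ^ i * g (s i))"
      by (intro integral_geometric_pmf lam)
    then show "(\<integral>p. g p \<partial>\<mu>) = (1 - lam) * (\<Sum>i. lam ^ i * g (s i))"
      unfolding \<mu>_def
      by (subst integral_distr) (auto intro: borel_measurable_continuous_onI[OF g])
  qed
  moreover have "\<mu>' = \<mu>" if "P \<mu>'" for \<mu>'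
    using that \<open>P \<mu>\<close> unfolding P_def
    by (intro Prob_eqI_zero_sets closed_zero_set_prod_discrete) auto
  ultimately have "P (THE \<mu>. P \<mu>)" by (rule theI)
  then have "P (empirical lam \<tau> x0 c a)"
    unfolding empirical_def P_def s_def .
  then show "empirical lam \<tau> x0 c a \<in> Prob"
    and "continuous_on UNIV g \<Longrightarrow> (\<integral>p. g p \<partial>empirical lam \<tau> x0 c a)
      = (1 - lam) * (\<Sum>i. lam ^ i * g (orbit \<tau> x0 a i, c i, a i))"
    unfolding P_def s_def by blast+
qed

text \<open>The terms are the increments of \<open>lam ^ i * u i\<close>, which tends to \<open>0\<close>.\<close>

lemma discounted_telescope_sums:
  fixes u :: "nat \<Rightarrow> real"
  assumes lam: "0 \<le> lam" "lam < 1" and u: "\<And>i. \<bar>u i\<bar> \<le> B"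
  shows "(\<lambda>i. lam ^ i * (lam * u (Suc i) - u i)) sums (- u 0)"
proof -
  have "(\<lambda>i. lam ^ i * u i) \<longlonglongrightarrow> 0"
  proof (rule Lim_null_comparison)
    show "\<forall>\<^sub>F i in sequentially. norm (lam ^ i * u i) \<le> lam ^ i * B"
      using lam u by (intro always_eventually) (simp add: abs_mult mult_left_mono)
    show "(\<lambda>i. lam ^ i * B) \<longlonglongrightarrow> 0"
      using lam by (intro tendsto_mult_left_zero LIMSEQ_power_zero) simp
  qed
  from telescope_sums[OF this] show ?thesis by (simp add: algebra_simps)
qed

lemma continuous_on_disc_diff:
  fixes \<tau> :: "'i::{finite,discrete_topology} \<Rightarrow> 'x::metric_space \<Rightarrow> 'x"
  assumes "\<And>a. continuous_on UNIV (\<tau> a)" and w: "continuous_on UNIV w"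
  shows "continuous_on UNIV (\<lambda>(x, c :: 'c::discrete_topology, a). disc_diff lam \<tau> w x a)"
  unfolding disc_diff_def
  by (intro continuous_on_prod_discrete)
     (auto intro!: continuous_intros continuous_on_compose2[OF w] assms)

text \<open>With \<open>u i = w (x\<^sub>i)\<close> along the orbit, the discounted sum of \<open>disc_diff\<close> is the telescoping
  series above, with value \<open>- w x0\<close>.\<close>

lemma empirical_holonomic:
  fixes \<tau> :: "'i::{finite,discrete_topology} \<Rightarrow> 'x::metric_space \<Rightarrow> 'x"
    and c :: "nat \<Rightarrow> 'c::{finite,discrete_topology}"
  assumes comp: "compact (UNIV :: 'x set)" and lam: "0 < lam" "lam < 1"
    and \<tau>: "\<And>a. continuous_on UNIV (\<tau> a)"
  shows "empirical lam \<tau> x0 c a \<in> holonomic lam \<tau> (return borel x0)"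
  unfolding holonomic_def
proof (intro CollectI conjI allI impI)
  show "empirical lam \<tau> x0 c a \<in> Prob" by (rule empirical_characterization(1)[OF comp lam])
  fix w :: "'x \<Rightarrow> real" assume w: "continuous_on UNIV w"
  obtain B where "\<And>x. \<bar>w x\<bar> \<le> B" using bounded_of_continuous_on_UNIV[OF comp w] by blast
  then have "(\<lambda>i. lam ^ i * (lam * w (orbit \<tau> x0 a (Suc i)) - w (orbit \<tau> x0 a i)))
      sums (- w (orbit \<tau> x0 a 0))"
    using lam by (intro discounted_telescope_sums) auto
  then have "(\<Sum>i. lam ^ i * disc_diff lam \<tau> w (orbit \<tau> x0 a i) (a i)) = - w x0"
    by (simp add: disc_diff_def sums_iff)
  then show "(\<integral>(x, c, a). disc_diff lam \<tau> w x a \<partial>empirical lam \<tau> x0 c a)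
      = - (1 - lam) * (\<integral>x. w x \<partial>return borel x0)"
    using borel_measurable_continuous_onI[OF w]
    by (simp add: empirical_characterization(2)[OF comp lam continuous_on_disc_diff[OF \<tau> w]]
        integral_return algebra_simps)
qed

section \<open>Duality between holonomic measures and the Bellman equation\<close>

lemma integrable_continuous_Prob:
  fixes g :: "'x::metric_space \<times> 'c::{finite,discrete_topology} \<times> 'i::{finite,discrete_topology} \<Rightarrow> real"
  assumes comp: "compact (UNIV :: 'x set)" and "\<mu> \<in> Prob" and g: "continuous_on UNIV g"
  shows "integrable \<mu> g"
proof -
  interpret prob_space \<mu> using assms by (simp add: Prob_def)
  have [measurable_cong]: "sets \<mu> = sets borel" using assms by (simp add: Prob_def)
  obtain B where "\<And>p. \<bar>g p\<bar> \<le> B"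
    using bounded_of_continuous_on_UNIV[OF compact_UNIV_prod_finite[OF comp] g] by blast
  then have "AE p in \<mu>. norm (g p) \<le> B" by (intro AE_I2) (simp only: real_norm_def)
  moreover have "g \<in> borel_measurable \<mu>"
    using borel_measurable_continuous_onI[OF g] by measurable
  ultimately show ?thesis by (intro integrable_const_bound)
qed

lemma continuous_on_payoff:
  fixes \<tau> :: "'i::{finite,discrete_topology} \<Rightarrow> 'x::metric_space \<Rightarrow> 'x"
    and A :: "'c::{finite,discrete_topology} \<Rightarrow> 'x \<Rightarrow> real"
  assumes A: "\<And>c. continuous_on UNIV (A c)" and \<tau>: "\<And>a. continuous_on UNIV (\<tau> a)"
  shows "continuous_on UNIV (\<lambda>(x, c, a). A c (\<tau> a x))"
  by (intro continuous_on_prod_discrete) (auto intro: continuous_on_compose2[OF A \<tau>])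

text \<open>Weak duality: the hypothesis on \<open>v\<close> bounds the integrand \<open>A c (\<tau> a x)\<close> by
  \<open>- disc_diff lam \<tau> v x a\<close>, and holonomy fixes the integral of the latter. So every continuous
  supersolution of the Bellman equation is a dual certificate.\<close>

lemma payoff_holonomic_le:
  fixes \<tau> :: "'i::{finite,discrete_topology} \<Rightarrow> 'x::metric_space \<Rightarrow> 'x"
    and A :: "'c::{finite,discrete_topology} \<Rightarrow> 'x \<Rightarrow> real"
  assumes comp: "compact (UNIV :: 'x set)"
    and A: "\<And>c. continuous_on UNIV (A c)" and \<tau>: "\<And>a. continuous_on UNIV (\<tau> a)"
    and v: "continuous_on UNIV v" and super: "\<And>x c a. A c (\<tau> a x) + lam * v (\<tau> a x) \<le> v x"
    and \<mu>: "\<mu> \<in> holonomic lam \<tau> \<nu>"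
  shows "payoff A \<tau> \<mu> \<le> (1 - lam) * (\<integral>x. v x \<partial>\<nu>)"
proof -
  have P: "\<mu> \<in> Prob" and
    hol: "(\<integral>(x, c, a). disc_diff lam \<tau> v x a \<partial>\<mu>) = - (1 - lam) * (\<integral>x. v x \<partial>\<nu>)"
    using \<mu> v by (auto simp: holonomic_def)
  note int = integrable_continuous_Prob[OF comp P]
  have "payoff A \<tau> \<mu> \<le> (\<integral>p. - (case p of (x, c, a) \<Rightarrow> disc_diff lam \<tau> v x a) \<partial>\<mu>)"
    unfolding payoff_def
  proof (rule integral_mono)
    show "integrable \<mu> (\<lambda>(x, c, a). A c (\<tau> a x))"
      by (intro int continuous_on_payoff A \<tau>)
    show "integrable \<mu> (\<lambda>p. - (case p of (x, c, a) \<Rightarrow> disc_diff lam \<tau> v x a))"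
      by (intro Bochner_Integration.integrable_minus int continuous_on_disc_diff \<tau> v)
    show "(case p of (x, c, a) \<Rightarrow> A c (\<tau> a x))
        \<le> - (case p of (x, c, a) \<Rightarrow> disc_diff lam \<tau> v x a)" for p
    proof (cases p)
      case (fields x c a)
      then show ?thesis using super[of c a x] by (simp add: disc_diff_def)
    qed
  qed
  also have "\<dots> = (1 - lam) * (\<integral>x. v x \<partial>\<nu>)"
    using hol by (simp add: algebra_simps)
  finally show ?thesis .
qed

text \<open>Complementary slackness: the empirical measure is concentrated on the orbit, where the bound
  is an equality, so the discounted sum of the rewards telescopes to \<open>v x0\<close>.\<close>

lemma payoff_empirical_eq:
  fixes \<tau> :: "'i::{finite,discrete_topology} \<Rightarrow> 'x::metric_space \<Rightarrow> 'x"
    and A :: "'c::{finite,discrete_topology} \<Rightarrow> 'x \<Rightarrow> real"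
  assumes comp: "compact (UNIV :: 'x set)" and lam: "0 < lam" "lam < 1"
    and A: "\<And>c. continuous_on UNIV (A c)" and \<tau>: "\<And>a. continuous_on UNIV (\<tau> a)"
    and v: "continuous_on UNIV v"
    and opt: "\<And>i. v (orbit \<tau> x0 a i) = A (c i) (orbit \<tau> x0 a (Suc i)) + lam * v (orbit \<tau> x0 a (Suc i))"
  shows "payoff A \<tau> (empirical lam \<tau> x0 c a) = (1 - lam) * v x0"
proof -
  obtain B where B: "\<And>x. \<bar>v x\<bar> \<le> B" using bounded_of_continuous_on_UNIV[OF comp v] by blast
  have "(\<lambda>i. lam ^ i * (lam * v (orbit \<tau> x0 a (Suc i)) - v (orbit \<tau> x0 a i)))
      sums (- v (orbit \<tau> x0 a 0))"
    using lam B by (intro discounted_telescope_sums) auto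
  from sums_minus[OF this]
  have "(\<lambda>i. - (lam ^ i * (lam * v (orbit \<tau> x0 a (Suc i)) - v (orbit \<tau> x0 a i)))) sums v x0"
    by simp
  moreover have "- (lam ^ i * (lam * v (orbit \<tau> x0 a (Suc i)) - v (orbit \<tau> x0 a i)))
      = lam ^ i * A (c i) (orbit \<tau> x0 a (Suc i))" for i
    by (simp add: opt[of i] algebra_simps)
  ultimately have "(\<lambda>i. lam ^ i * A (c i) (orbit \<tau> x0 a (Suc i))) sums v x0"
    by (simp only:)
  then show ?thesis
    unfolding payoff_def
    by (simp add: empirical_characterization(2)[OF comp lam continuous_on_payoff[OF A \<tau>]] sums_iff)
qed

theorem theorem3p4:
  fixes \<tau> :: "'i::{finite,discrete_topology} \<Rightarrow> 'x::metric_space \<Rightarrow> 'x"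
    and A :: "'c::{finite,discrete_topology} \<Rightarrow> 'x \<Rightarrow> real"
    and lam :: real
  assumes "compact (UNIV :: 'x set)"
    and "contractive_ifs \<tau>"
    and "\<forall>c. \<exists>L. L-lipschitz_on UNIV (A c)"
    and "0 < lam" and "lam < 1"
  shows "(\<forall>x0 (c :: nat \<Rightarrow> 'c) a. empirical lam \<tau> x0 c a \<in> holonomic lam \<tau> (return borel x0)) \<and>
    (\<forall>x0 c a. (\<forall>x. bellman_value lam A \<tau> x \<le> bellman_value lam A \<tau> x0) \<longrightarrow>
       optimal_at lam A \<tau> x0 c a \<longrightarrow>
       max_payoff lam A \<tau> (return borel x0) = (1 - lam) * (SUP x. bellman_value lam A \<tau> x) \<and>
       empirical lam \<tau> x0 c a \<in> holonomic lam \<tau> (return borel x0) \<and>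
       payoff A \<tau> (empirical lam \<tau> x0 c a) = max_payoff lam A \<tau> (return borel x0))"
proof -
  have comp: "compact (UNIV :: 'x set)" and lam: "0 < lam" "lam < 1" by fact+
  have \<tau>: "continuous_on UNIV (\<tau> a)" for a
    using \<open>contractive_ifs \<tau>\<close> unfolding contractive_ifs_def
    by (meson lipschitz_on_continuous_on)
  have A: "continuous_on UNIV (A c)" for c
    using assms(3) by (meson lipschitz_on_continuous_on)
  let ?v = "bellman_value lam A \<tau>"
  have lam0: "0 \<le> lam" using lam by simp
  have v: "continuous_on UNIV ?v"
    by (rule bellman_value_solves(1)[OF comp lam0 lam(2) A \<tau>])
  have hol: "empirical lam \<tau> x0 c a \<in> holonomic lam \<tau> (return borel x0)"
    for x0 and c :: "nat \<Rightarrow> 'c" and a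
    by (rule empirical_holonomic[OF comp lam \<tau>])
  have "max_payoff lam A \<tau> (return borel x0) = (1 - lam) * (SUP x. ?v x) \<and>
      payoff A \<tau> (empirical lam \<tau> x0 c a) = max_payoff lam A \<tau> (return borel x0)"
    if max: "\<forall>x. ?v x \<le> ?v x0" and opt: "optimal_at lam A \<tau> x0 c a" for x0 c a
  proof -
    have attained: "payoff A \<tau> (empirical lam \<tau> x0 c a) = (1 - lam) * ?v x0"
      using opt by (intro payoff_empirical_eq comp lam A \<tau> v) (simp add: optimal_at_def)
    have bound: "payoff A \<tau> \<mu> \<le> (1 - lam) * ?v x0"
      if "\<mu> \<in> holonomic lam \<tau> (return borel x0)" for \<mu>
      using payoff_holonomic_le[OF comp A \<tau> v bellman_value_ge[OF comp lam0 lam(2) A \<tau>] that]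
        borel_measurable_continuous_onI[OF v] by (simp add: integral_return)
    have "max_payoff lam A \<tau> (return borel x0) = (1 - lam) * ?v x0"
      unfolding max_payoff_def
      by (rule cSup_eq_maximum) (use attained[symmetric] hol bound in auto)
    moreover have "(SUP x. ?v x) = ?v x0"
      by (rule cSup_eq_maximum) (use max in auto)
    ultimately show ?thesis using attained by simp
  qed
  then show ?thesis using hol by blast
qed

end
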